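(* Let $n\ge 1$ and $k\ge 1$ be integers. (i) There exists an MPNN with $2$ iterations that exactly solves the transfer task on $\mathcal{G}_{n,k}$. (ii) Let $b\ge 1$ be an integer. Consider any MPNN computed in $b$-bit floating-point arithmetic (so that each coordinate of every computed node feature takes one of at most $2^b$ values) that exactly solves the transfer task on $\mathcal{G}_{n,k}$ with $M$ iterations. For $j=1,\dots,M$, let $d_j$ be the dimension of the node features after iteration $j$, in particular of the feature $h_c^j$ of any central node $c$. Then $$\sum_{j=1}^{M} d_j\ \ge\ \frac{n}{2b}\log_2\!\left(\frac n2\right).$$
   Context: Graphs are finite, simple and undirected. $\mathcal{N}_v$ denotes the set of neighbors of node $v$. A graph comes with input node features $(x_v)_{v\in V}$, which are real vectors. **MPNN.** A Message Passing Neural Network with $M$ iterations consists of functions $\phi_j,\psi_j$, $j=0,\dots,M-1$. Here $\psi_j$ maps finite multisets of vectors to vectors (so it is permutation invariant), and $\phi_j$ maps pairs of vectors to a vector; these may be arbitrary functions. The MPNN computes $$h_v^0=x_v,\qquad h_v^{j+1}=\phi_j\big(h_v^j,\ \psi_j(\{\!\{h_u^j : u\in\mathcal{N}_v\}\!\})\big),\qquad j=0,\dots,M-1.$$ The same functions are used at all nodes. The dimension of $h_v^j$ depends only on $j$ and is denoted $d_j$. **The (generalized) Two-Radius family $\mathcal{G}_{n,k}$.** Each graph in $\mathcal{G}_{n,k}$ has node set $V=S\sqcup C\sqcup T$ with $n$ source nodes ($S$), $k$ central nodes ($C$) and $n$ target nodes ($T$). Each central node is adjacent to all source nodes and all target nodes,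 and there are no other edges. Each node feature is a pair $x_v=(\iota_v,\ell_v)$ of an identifier and a label, both encoded as one-hot vectors: - The sources have distinct identifiers $\iota_s\in\{1,\dots,n\}$ and distinct labels $\ell_s\in\{1,\dots,n\}$ (the label need not equal the identifier). - The targets have distinct identifiers $\iota_v\in\{1,\dots,n\}$, and their input label is a fixed constant carrying no information. - All central nodes have identifier $0$ and the same fixed constant label. The family $\mathcal{G}_{n,k}$ consists of all graphs arising from all such assignments of identifiers and labels. **Solving the transfer task.** Fix an injective encoding of the labels $\{1,\dots,n\}$ as vectors (e.g. one-hot). An MPNN with $M$ iterations exactly solves the transfer task on $\mathcal{G}_{n,k}$ if, for every graph in $\mathcal{G}_{n,k}$, every target $v\in T$ and the source $s\in S$ with $\iota_s=\iota_v$, the output satisfies $h_v^M=\ell_s$ (the encoding of $\ell_s$). *)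

theory Defs
  imports "Graph_Theory.Pair_Digraph" "Jordan_Normal_Form.Matrix" Complex_Main
    "HOL-Library.Multiset"
begin

text \<open>Simple undirected graphs are the locale \<^locale>\<open>pair_graph\<close>: finite, loop-free and with a
  symmetric arc relation.\<close>

definition neighbors :: "'v pair_pre_digraph \<Rightarrow> 'v \<Rightarrow> 'v set" where
  "neighbors G v = {u. (u, v) \<in> parcs G}"

record mpnn =
  iters :: nat
  fdim :: "nat \<Rightarrow> nat"
  upd :: "nat \<Rightarrow> real vec \<Rightarrow> real vec \<Rightarrow> real vec"
  agg :: "nat \<Rightarrow> real vec multiset \<Rightarrow> real vec"

text \<open>The update and aggregation functions are arbitrary; the only typing condition is that the
  dimension of the features after iteration \<open>j\<close> is \<open>fdim A j\<close>. The dimension of the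
  messages returned by \<open>agg A j\<close> is unconstrained.\<close>

definition is_mpnn :: "mpnn \<Rightarrow> bool" where
  "is_mpnn A \<longleftrightarrow>
     (\<forall>j < iters A. \<forall>h \<in> carrier_vec (fdim A j). \<forall>m. upd A j h m \<in> carrier_vec (fdim A (Suc j)))"

primrec mpnn_feature ::
  "mpnn \<Rightarrow> 'v pair_pre_digraph \<Rightarrow> ('v \<Rightarrow> real vec) \<Rightarrow> nat \<Rightarrow> 'v \<Rightarrow> real vec" where
  "mpnn_feature A G x 0 v = x v"
| "mpnn_feature A G x (Suc j) v =
     upd A j (mpnn_feature A G x j v)
       (agg A j (image_mset (mpnn_feature A G x j) (mset_set (neighbors G v))))"

text \<open>Identifiers and labels are numbers in \<open>{0..n}\<close>, where \<open>0\<close> is the identifier of the central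
  nodes. Sources carry labels in \<open>{1..n}\<close>; the constant input labels \<open>lT\<close> of the targets and \<open>lC\<close>
  of the central nodes may be any fixed elements of \<open>{0..n}\<close>. The node type is \<^typ>\<open>nat\<close>, so that
  every finite graph occurs up to isomorphism.\<close>

definition two_radius ::
  "nat \<Rightarrow> nat \<Rightarrow> nat \<Rightarrow> nat \<Rightarrow> nat pair_pre_digraph \<Rightarrow> nat set \<Rightarrow> nat set \<Rightarrow> nat set
    \<Rightarrow> (nat \<Rightarrow> nat) \<Rightarrow> (nat \<Rightarrow> nat) \<Rightarrow> bool" where
  "two_radius n k lT lC G S C T ident lab \<longleftrightarrow>
     pair_graph G \<and>
     pverts G = S \<union> C \<union> T \<and> S \<inter> C = {} \<and> S \<inter> T = {} \<and> C \<inter> T = {} \<and>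
     card S = n \<and> card C = k \<and> card T = n \<and>
     parcs G = C \<times> (S \<union> T) \<union> (S \<union> T) \<times> C \<and>
     inj_on ident S \<and> ident ` S \<subseteq> {1..n} \<and> inj_on lab S \<and> lab ` S \<subseteq> {1..n} \<and>
     inj_on ident T \<and> ident ` T \<subseteq> {1..n} \<and> (\<forall>t \<in> T. lab t = lT) \<and>
     (\<forall>c \<in> C. ident c = 0 \<and> lab c = lC)"

definition input_feature :: "nat \<Rightarrow> (nat \<Rightarrow> nat) \<Rightarrow> (nat \<Rightarrow> nat) \<Rightarrow> nat \<Rightarrow> real vec" where
  "input_feature n ident lab v = unit_vec (n + 1) (ident v) @\<^sub>v unit_vec (n + 1) (lab v)"

definition solves_transfer ::
  "nat \<Rightarrow> nat \<Rightarrow> nat \<Rightarrow> nat \<Rightarrow> (nat \<Rightarrow> real vec) \<Rightarrow> mpnn \<Rightarrow> bool" where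
  "solves_transfer n k lT lC enc A \<longleftrightarrow>
     fdim A 0 = 2 * (n + 1) \<and>
     (\<forall>G S C T ident lab. two_radius n k lT lC G S C T ident lab \<longrightarrow>
        (\<forall>v \<in> T. \<forall>s \<in> S. ident s = ident v \<longrightarrow>
           mpnn_feature A G (input_feature n ident lab) (iters A) v = enc (lab s)))"

text \<open>A fixed \<open>b\<close>-bit number format satisfies this with one set \<open>F\<close> for all coordinates and
  iterations.\<close>

definition b_bit_features :: "nat \<Rightarrow> nat \<Rightarrow> nat \<Rightarrow> nat \<Rightarrow> nat \<Rightarrow> mpnn \<Rightarrow> bool" where
  "b_bit_features b n k lT lC A \<longleftrightarrow>
     (\<forall>j \<in> {1..iters A}. \<forall>i < fdim A j. \<exists>F :: real set. finite F \<and> card F \<le> 2 ^ b \<and>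
        (\<forall>G S C T ident lab. two_radius n k lT lC G S C T ident lab \<longrightarrow>
           (\<forall>v \<in> pverts G. mpnn_feature A G (input_feature n ident lab) j v $ i \<in> F)))"

end

theory Submission
  imports Defs "HOL-Combinatorics.Permutations"
begin

text \<open>For (i), let every central node store, for each identifier \<open>i\<close>, the sum of the labels of its
  neighbors with identifier \<open>i\<close>. This sum is the label of the source \<open>i\<close> plus the constant \<open>lT\<close>, so
  the targets can decode it even if \<open>lT\<close> coincides with a source label.

  For (ii), fix everything except the labels of the sources. All central nodes have the same feature
  in every iteration, and the sequence of these features determines the outputs at all targets,
  hence the labels. So the \<open>n!\<close> labelings yield distinct sequences, of which there are at most
  \<open>2 ^ (b * \<Sum>d\<^sub>j)\<close>. Finally \<open>(n!)\<^sup>2 = (\<Prod>i=1..n. i (n + 1 - i)) \<ge> n ^ n\<close>.\<close>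

section \<open>Features of message passing networks\<close>

lemma mpnn_feature_carrier:
  assumes "is_mpnn A" "x v \<in> carrier_vec (fdim A 0)" "j \<le> iters A"
  shows "mpnn_feature A G x j v \<in> carrier_vec (fdim A j)"
  using assms(3)
proof (induction j)
  case (Suc j)
  then show ?case using assms(1) by (simp add: is_mpnn_def)
qed (use assms in simp)

text \<open>Equal neighborhoods give equal aggregated multisets, so equal inputs stay equal. This
  lets a single central node stand for all of them.\<close>

lemma mpnn_feature_twins:
  assumes "neighbors G u = neighbors G v" "x u = x v"
  shows "mpnn_feature A G x j u = mpnn_feature A G x j v"
  using assms by (induction j) simp_all

text \<open>A node learns about the rest of the graph only through the features of its neighbors in
  earlier iterations. For a target these are the features of the central nodes, which form the
  bottleneck.\<close>

lemma mpnn_feature_cong: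
  assumes "x v = y v" "finite (neighbors G v)"
    and "\<And>i u. i < j \<Longrightarrow> u \<in> neighbors G v \<Longrightarrow> mpnn_feature A G x i u = mpnn_feature A G y i u"
  shows "mpnn_feature A G x j v = mpnn_feature A G y j v"
  using assms(3)
proof (induction j)
  case (Suc j)
  have "image_mset (mpnn_feature A G x j) (mset_set (neighbors G v)) =
        image_mset (mpnn_feature A G y j) (mset_set (neighbors G v))"
    using Suc.prems assms(2) by (intro image_mset_cong) auto
  then show ?case using Suc by simp
qed (use assms in simp)

lemma input_feature_carrier: "input_feature n ident lab v \<in> carrier_vec (2 * (n + 1))"
proof -
  have "input_feature n ident lab v \<in> carrier_vec ((n + 1) + (n + 1))"
    unfolding input_feature_def by (intro append_carrier_vec) auto
  then show ?thesis by (simp add: mult_2)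
qed

lemma input_feature_ident:
  "i \<le> n \<Longrightarrow> ident v \<le> n \<Longrightarrow> input_feature n ident lab v $ i = (if ident v = i then 1 else 0)"
  by (simp add: input_feature_def index_append_vec)

lemma input_feature_lab:
  "l \<le> n \<Longrightarrow> lab v \<le> n \<Longrightarrow>
    input_feature n ident lab v $ (n + 1 + l) = (if lab v = l then 1 else 0)"
  by (simp add: input_feature_def index_append_vec)

lemma two_radius_neighbors:
  assumes "two_radius n k lT lC G S C T ident lab"
  shows "v \<in> S \<union> T \<Longrightarrow> neighbors G v = C" and "v \<in> C \<Longrightarrow> neighbors G v = S \<union> T"
  using assms unfolding two_radius_def neighbors_def by auto

section \<open>Solving the transfer task in two iterations\<close>

text \<open>The scalar product of the one-hot label block, which starts at position
  \<open>n + 1\<close>, with (0, ..., n): it turns the code back into a number.\<close>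

definition feature_label :: "nat \<Rightarrow> real vec \<Rightarrow> real" where
  "feature_label n h = (\<Sum>l\<le>n. real l * h $ (n + 1 + l))"

text \<open>Here \<open>h\<close> is the feature of a target, whose one-hot block selects the
  position \<open>i\<close>, and \<open>m\<close> is the feature of a central node. Solving for
  \<open>l\<close> removes the summand \<open>lT\<close>. The default 1 keeps the result in
  \<open>{1..n}\<close> for arbitrary \<open>h\<close> and \<open>m\<close>, because
  \<open>is_mpnn\<close> constrains the update on all such arguments and \<open>enc\<close> has a
  known dimension only on labels.\<close>

definition decode_label :: "nat \<Rightarrow> nat \<Rightarrow> real vec \<Rightarrow> real vec \<Rightarrow> nat" where
  "decode_label n lT h m =
     (let P = (\<lambda>l. l \<in> {1..n} \<and> (\<exists>i\<le>n. h $ i = 1 \<and> m $ (n + 1 + i) = real (l + lT)))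
      in if \<exists>l. P l then SOME l. P l else 1)"

text \<open>After the first iteration a feature consists of the one-hot identifier followed by the sums of
  the labels of the neighbors, indexed by their identifiers.\<close>

definition transfer_mpnn :: "nat \<Rightarrow> nat \<Rightarrow> nat \<Rightarrow> (nat \<Rightarrow> real vec) \<Rightarrow> mpnn" where
  "transfer_mpnn n lT e enc =
     \<lparr>iters = 2,
      fdim = (\<lambda>j. if j = 2 then e else 2 * (n + 1)),
      upd = (\<lambda>j h m. if j = 0
        then vec (2 * (n + 1)) (\<lambda>i. if i \<le> n then h $ i else m $ (i - (n + 1)))
        else enc (decode_label n lT h m)),
      agg = (\<lambda>j M. if j = 0
        then vec (n + 1) (\<lambda>i. \<Sum>h\<in>#M. h $ i * feature_label n h)
        else (SOME h. h \<in># M))\<rparr>"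

lemma decode_label_range: "n \<ge> 1 \<Longrightarrow> decode_label n lT h m \<in> {1..n}"
  unfolding decode_label_def Let_def by (auto dest!: someI_ex)

text \<open>The one-hot block admits only the position \<open>i\<close>, and cancelling
  \<open>lT\<close> then leaves \<open>l\<close> as the unique candidate for the choice
  operator.\<close>

lemma decode_label_eq:
  assumes "l \<in> {1..n}" "i \<le> n" "\<And>i'. i' \<le> n \<Longrightarrow> h $ i' = (if i' = i then 1 else 0)"
    and "m $ (n + 1 + i) = real (l + lT)"
  shows "decode_label n lT h m = l"
proof -
  have "(l' \<in> {1..n} \<and> (\<exists>i'\<le>n. h $ i' = 1 \<and> m $ (n + 1 + i') = real (l' + lT))) \<longleftrightarrow> l' = l" for l'
    using assms by (auto split: if_splits)
  then show ?thesis by (simp add: decode_label_def)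
qed

lemma feature_label_input:
  assumes "lab v \<le> n"
  shows "feature_label n (input_feature n ident lab v) = real (lab v)"
proof -
  have "feature_label n (input_feature n ident lab v) =
      (\<Sum>l\<le>n. if l = lab v then real l else 0)"
    unfolding feature_label_def
  proof (intro sum.cong refl)
    fix l assume "l \<in> {..n}"
    then show "real l * input_feature n ident lab v $ (n + 1 + l) =
        (if l = lab v then real l else 0)"
      using input_feature_lab[of l n lab v ident] assms by auto
  qed
  then show ?thesis using assms by simp
qed

lemma is_mpnn_transfer:
  assumes "n \<ge> 1" "\<And>l. l \<in> {1..n} \<Longrightarrow> enc l \<in> carrier_vec e"
  shows "is_mpnn (transfer_mpnn n lT e enc)"
  unfolding is_mpnn_def transfer_mpnn_def
  using assms(2)[OF decode_label_range[OF assms(1)]] by (auto simp: less_2_cases_iff)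

text \<open>Distinct identifiers leave a single nonzero summand. It is applied once to the sources
  and once to the targets.\<close>

lemma sum_labels_of_ident:
  fixes lab :: "'a \<Rightarrow> nat"
  assumes "finite S" "inj_on ident S" "s \<in> S"
  shows "(\<Sum>u\<in>S. (if ident u = ident s then 1 else 0) * real (lab u)) = real (lab s)"
proof -
  have "(\<Sum>u\<in>S. (if ident u = ident s then 1 else 0) * real (lab u)) =
      (\<Sum>u\<in>S. if u = s then real (lab u) else 0)"
    using assms(2,3) by (intro sum.cong) (auto simp: inj_on_def)
  then show ?thesis using assms by simp
qed

lemma solves_transfer_transfer_mpnn:
  assumes "n \<ge> 1" "k \<ge> 1" "lT \<le> n"
  shows "solves_transfer n k lT lC enc (transfer_mpnn n lT e enc)"
  unfolding solves_transfer_def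
proof (intro conjI allI impI ballI)
  let ?A = "transfer_mpnn n lT e enc"
  show "fdim ?A 0 = 2 * (n + 1)" by (simp add: transfer_mpnn_def)
  fix G S C T ident lab v s
  assume tr: "two_radius n k lT lC G S C T ident lab" and v: "v \<in> T" and s: "s \<in> S"
    and sv: "ident s = ident v"
  let ?x = "input_feature n ident lab"
  have cards: "card S = n" "card C = k" "card T = n"
    and inj: "inj_on ident S" "inj_on ident T"
    and ident: "ident ` S \<subseteq> {1..n}" "ident ` T \<subseteq> {1..n}" and lab: "lab ` S \<subseteq> {1..n}"
    and labT: "\<And>t. t \<in> T \<Longrightarrow> lab t = lT" and disj: "S \<inter> T = {}"
    using tr by (auto simp: two_radius_def)
  \<comment> \<open>Infinite sets have \<open>card\<close> 0, so the positive cardinalities yield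
    finiteness.\<close>
  have fin: "finite S" "finite C" "finite T" and "C \<noteq> {}"
    using cards assms by (auto intro!: card_ge_0_finite)
  have le: "ident u \<le> n" "lab u \<le> n" if "u \<in> S \<union> T" for u
    using that ident lab labT assms(3) by auto
  \<comment> \<open>The identifier of \<open>v\<close> occurs exactly twice among the neighbors of
    \<open>c\<close>: at the source \<open>s\<close> and at \<open>v\<close> itself, which
    contributes \<open>lT\<close>.\<close>
  have centre: "mpnn_feature ?A G ?x 1 c $ (n + 1 + ident v) = real (lab s + lT)" if "c \<in> C" for c
  proof -
    have "mpnn_feature ?A G ?x 1 c $ (n + 1 + ident v) =
        (\<Sum>u\<in>S \<union> T. ?x u $ ident v * feature_label n (?x u))"
      using le(1)[of v] v
      by (simp add: transfer_mpnn_def two_radius_neighbors(2)[OF tr that] sum_unfold_sum_mset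
          image_mset.compositionality comp_def)
    also have "\<dots> = (\<Sum>u\<in>S \<union> T. (if ident u = ident v then 1 else 0) * real (lab u))"
      using le v by (intro sum.cong refl) (simp add: input_feature_ident feature_label_input)
    also have "\<dots> = real (lab s) + real (lab v)"
      using sum_labels_of_ident[OF fin(1) inj(1) s, of lab]
        sum_labels_of_ident[OF fin(3) inj(2) v, of lab] fin disj sv
      by (simp add: sum.union_disjoint)
    finally show ?thesis using labT[OF v] by simp
  qed
  have target: "mpnn_feature ?A G ?x 1 v $ i = (if i = ident v then 1 else 0)" if "i \<le> n" for i
    using that le(1)[of v] v by (auto simp: transfer_mpnn_def input_feature_ident)
  \<comment> \<open>The second aggregation picks an arbitrary central feature. Some central node
    exists, and \<open>centre\<close> holds for every one of them, so any choice can be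
    decoded.\<close>
  define m where "m = (SOME h. h \<in># image_mset (mpnn_feature ?A G ?x 1) (mset_set C))"
  have "\<exists>h. h \<in># image_mset (mpnn_feature ?A G ?x 1) (mset_set C)"
    using \<open>C \<noteq> {}\<close> fin(2) by auto
  then have "m \<in># image_mset (mpnn_feature ?A G ?x 1) (mset_set C)"
    unfolding m_def by (rule someI_ex)
  then have "m $ (n + 1 + ident v) = real (lab s + lT)"
    using centre fin(2) by auto
  then have "decode_label n lT (mpnn_feature ?A G ?x 1 v) m = lab s"
    using target le(1)[of v] v s lab by (intro decode_label_eq) auto
  moreover have "mpnn_feature ?A G ?x (Suc 1) v =
      enc (decode_label n lT (mpnn_feature ?A G ?x 1 v) m)"
    unfolding mpnn_feature.simps(2) m_def using two_radius_neighbors(1)[OF tr, of v] v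
    by (simp add: transfer_mpnn_def del: mpnn_feature.simps)
  ultimately show "mpnn_feature ?A G ?x (iters ?A) v = enc (lab s)"
    by (simp add: transfer_mpnn_def numeral_2_eq_2 del: mpnn_feature.simps)
qed

section \<open>Counting trajectories of the central nodes\<close>

text \<open>The sources are 1, ..., n, followed by k central nodes and then n targets. Source
  \<open>i\<close> and target \<open>n + k + i\<close> will share the identifier \<open>i\<close>,
  and only the labels of the sources will vary.\<close>

definition std_graph :: "nat \<Rightarrow> nat \<Rightarrow> nat pair_pre_digraph" where
  "std_graph n k =
     (let C = {n<..n + k}; ST = {1..n} \<union> {n + k<..n + k + n}
      in \<lparr>pverts = C \<union> ST, parcs = C \<times> ST \<union> ST \<times> C\<rparr>)"

text \<open>Truncated subtraction gives the central nodes the identifier 0.\<close>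

definition std_ident :: "nat \<Rightarrow> nat \<Rightarrow> nat \<Rightarrow> nat" where
  "std_ident n k v = (if v \<le> n then v else v - (n + k))"

definition std_lab :: "nat \<Rightarrow> nat \<Rightarrow> nat \<Rightarrow> nat \<Rightarrow> (nat \<Rightarrow> nat) \<Rightarrow> nat \<Rightarrow> nat" where
  "std_lab n k lT lC p v = (if v \<le> n then p v else if v \<le> n + k then lC else lT)"

lemma two_radius_std:
  assumes "p permutes {1..n}"
  shows "two_radius n k lT lC (std_graph n k) {1..n} {n<..n + k} {n + k<..n + k + n}
    (std_ident n k) (std_lab n k lT lC p)"
proof -
  have "pair_graph (std_graph n k)"
    by unfold_locales (auto simp: std_graph_def Let_def symmetric_def intro!: symI)
  moreover have "inj_on (std_lab n k lT lC p) {1..n}"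
    using permutes_inj[OF assms] by (auto simp: inj_on_def std_lab_def)
  moreover have "std_lab n k lT lC p ` {1..n} \<subseteq> {1..n}"
  proof -
    have "std_lab n k lT lC p ` {1..n} = p ` {1..n}"
      by (intro image_cong) (simp_all add: std_lab_def)
    then show ?thesis using permutes_image[OF assms] by simp
  qed
  moreover have "inj_on (std_ident n k) {1..n}" "std_ident n k ` {1..n} \<subseteq> {1..n}"
    "inj_on (std_ident n k) {n + k<..n + k + n}"
    "std_ident n k ` {n + k<..n + k + n} \<subseteq> {1..n}"
    "\<forall>c\<in>{n<..n + k}. std_ident n k c = 0 \<and> std_lab n k lT lC p c = lC"
    "\<forall>t\<in>{n + k<..n + k + n}. std_lab n k lT lC p t = lT"
    by (auto simp: inj_on_def std_ident_def std_lab_def)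
  moreover have "{1..n} \<inter> {n<..n + k} = {}" "{1..n} \<inter> {n + k<..n + k + n} = {}"
    "{n<..n + k} \<inter> {n + k<..n + k + n} = {}"
    by auto
  moreover have "pverts (std_graph n k) = {1..n} \<union> {n<..n + k} \<union> {n + k<..n + k + n}"
    by (auto simp: std_graph_def Let_def)
  ultimately show ?thesis
    unfolding two_radius_def by (simp add: std_graph_def Let_def)
qed

text \<open>A vector is determined by its coordinate function, so the set is covered by the image of
  a finite product of the \<open>F i\<close>.\<close>

lemma vecs_with_coords_finite_card:
  fixes F :: "nat \<Rightarrow> 'a set"
  assumes "\<And>i. i < d \<Longrightarrow> finite (F i) \<and> card (F i) \<le> q"
  defines "B \<equiv> {v \<in> carrier_vec d. \<forall>i<d. v $ i \<in> F i}"
  shows "finite B" "card B \<le> q ^ d"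
proof -
  have B: "B \<subseteq> vec d ` (PiE {..<d} F)"
  proof
    fix v assume v: "v \<in> B"
    then have "v = vec d (\<lambda>i\<in>{..<d}. v $ i)"
      by (auto simp: B_def)
    moreover have "(\<lambda>i\<in>{..<d}. v $ i) \<in> PiE {..<d} F" using v by (auto simp: B_def)
    ultimately show "v \<in> vec d ` (PiE {..<d} F)" by blast
  qed
  have fin: "finite (PiE {..<d} F)" using assms(1) by (intro finite_PiE) auto
  then show "finite B" using B finite_subset by blast
  have "card B \<le> card (PiE {..<d} F)"
    using B fin by (meson card_image_le card_mono finite_imageI le_trans)
  also have "\<dots> = (\<Prod>i<d. card (F i))" by (simp add: card_PiE)
  also have "\<dots> \<le> (\<Prod>i<d. q)" using assms(1) by (intro prod_mono) auto
  finally show "card B \<le> q ^ d" by simp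
qed

lemma fact_le_trajectories:
  assumes n: "n \<ge> 1" and k: "k \<ge> 1" and enc: "inj_on enc {1..n}"
    and A: "is_mpnn A" "b_bit_features b n k lT lC A" "solves_transfer n k lT lC enc A"
  shows "fact n \<le> (2::nat) ^ (b * (\<Sum>j = 1..iters A. fdim A j))"
proof -
  define G where "G = std_graph n k"
  define x where "x p = input_feature n (std_ident n k) (std_lab n k lT lC p)" for p
  define h where "h p = mpnn_feature A G (x p)" for p
  define P where "P = {p. p permutes {1..n}}"
  \<comment> \<open>The first central node of the standard graph, present because \<open>k\<close>
    is at least 1.\<close>
  define c where "c = n + 1"
  have tr: "two_radius n k lT lC G {1..n} {n<..n + k} {n + k<..n + k + n}
      (std_ident n k) (std_lab n k lT lC p)" if "p \<in> P" for p
    unfolding G_def using that two_radius_std by (simp add: P_def)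
  have id: "id \<in> P" by (simp add: P_def permutes_id)
  \<comment> \<open>Naming the property makes it possible to choose the value sets
    \<open>F j i\<close> simultaneously. They are fixed before the labeling, so one box
    \<open>B j\<close> serves all permutations.\<close>
  define Q where "Q j i F \<longleftrightarrow> finite F \<and> card F \<le> 2 ^ b \<and>
      (\<forall>G S C T ident lab. two_radius n k lT lC G S C T ident lab \<longrightarrow>
         (\<forall>v \<in> pverts G. mpnn_feature A G (input_feature n ident lab) j v $ i \<in> F))"
    for j i and F :: "real set"
  have "\<forall>j\<in>{1..iters A}. \<forall>i<fdim A j. \<exists>F. Q j i F"
    using A(2) unfolding b_bit_features_def Q_def by blast
  then obtain F where F: "\<And>j i. j \<in> {1..iters A} \<Longrightarrow> i < fdim A j \<Longrightarrow> Q j i (F j i)"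
    by metis
  define B where "B j = {v \<in> carrier_vec (fdim A j). \<forall>i<fdim A j. v $ i \<in> F j i}" for j
  have B: "finite (B j)" "card (B j) \<le> (2 ^ b) ^ fdim A j" if "j \<in> {1..iters A}" for j
    unfolding B_def using vecs_with_coords_finite_card[of "fdim A j" "F j" "2 ^ b"] F[OF that]
    by (auto simp: Q_def)
  \<comment> \<open>The restriction makes trajectories extensional, hence elements of
    \<open>PiE\<close>.\<close>
  define traj where "traj p = (\<lambda>j\<in>{1..iters A}. h p j c)" for p
  have "c \<in> pverts G" using k by (auto simp: c_def G_def std_graph_def Let_def)
  have in_B: "h p j c \<in> B j" if "p \<in> P" "j \<in> {1..iters A}" for p j
  proof -
    have "h p j c \<in> carrier_vec (fdim A j)"
      unfolding h_def using A that input_feature_carrier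
      by (intro mpnn_feature_carrier) (auto simp: x_def solves_transfer_def)
    moreover have "h p j c $ i \<in> F j i" if "i < fdim A j" for i
      using F[OF \<open>j \<in> _\<close> that] tr[OF \<open>p \<in> P\<close>] \<open>c \<in> pverts G\<close>
      unfolding Q_def h_def x_def by blast
    ultimately show ?thesis by (simp add: B_def)
  qed
  have central: "h p j u = h p j c" if "p \<in> P" "u \<in> {n<..n + k}" for p j u
    unfolding h_def
  proof (rule mpnn_feature_twins)
    have "c \<in> {n<..n + k}" using k by (simp add: c_def)
    then show "neighbors G u = neighbors G c"
      using two_radius_neighbors(2)[OF tr[OF that(1)]] that(2) by blast
    show "x p u = x p c"
      using that k by (simp add: x_def input_feature_def std_ident_def std_lab_def c_def)
  qed
  have "inj_on traj P"
  proof (rule inj_onI)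
    fix p q assume p: "p \<in> P" and q: "q \<in> P" and "traj p = traj q"
    then have pos: "h p j c = h q j c" if "j \<in> {1..iters A}" for j
      using that unfolding traj_def by (metis restrict_apply')
    \<comment> \<open>Trajectories start at iteration 1. The input of \<open>c\<close> does not
      involve the labels of the sources, so agreement extends to iteration 0.\<close>
    have "h p 0 c = h q 0 c"
      using k by (simp add: h_def x_def input_feature_def std_lab_def c_def)
    with pos have eq: "h p j c = h q j c" if "j \<le> iters A" for j
      using that by (cases "j = 0") auto
    have "p i = q i" if i: "i \<in> {1..n}" for i
    proof -
      \<comment> \<open>The target that must output the label of source \<open>i\<close>, namely
        \<open>enc (p i)\<close>.\<close>
      let ?t = "n + k + i"
      have t: "?t \<in> {n + k<..n + k + n}" using i by auto
      have nb: "neighbors G ?t = {n<..n + k}"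
        using two_radius_neighbors(1)[OF tr[OF p], of ?t] t by blast
      have "h p (iters A) ?t = h q (iters A) ?t"
        unfolding h_def
      proof (rule mpnn_feature_cong)
        show "x p ?t = x q ?t"
          using i by (simp add: x_def input_feature_def std_lab_def)
        show "mpnn_feature A G (x p) j u = mpnn_feature A G (x q) j u"
          if "j < iters A" "u \<in> neighbors G ?t" for j u
          using that eq[of j] central[OF p, of u j] central[OF q, of u j] by (simp add: nb h_def)
      qed (simp add: nb)
      moreover have "h r (iters A) ?t = enc (r i)" if "r \<in> P" for r
      proof -
        have "std_ident n k i = std_ident n k ?t" using i k by (simp add: std_ident_def)
        then have "h r (iters A) ?t = enc (std_lab n k lT lC r i)"
          using A(3) tr[OF that] t i unfolding solves_transfer_def h_def x_def by blast
        then show ?thesis using i by (simp add: std_lab_def)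
      qed
      ultimately have "enc (p i) = enc (q i)" using p q by simp
      moreover have "p i \<in> {1..n}" "q i \<in> {1..n}"
        using permutes_in_image[of p "{1..n}" i] permutes_in_image[of q "{1..n}" i] p q i
        unfolding P_def by blast+
      ultimately show ?thesis using enc by (simp add: inj_on_eq_iff)
    qed
    then show "p = q"
      using p q unfolding P_def by (intro ext) (metis mem_Collect_eq permutes_not_in)
  qed
  moreover have "traj ` P \<subseteq> PiE {1..iters A} B"
    using in_B by (auto simp: traj_def)
  moreover have "finite (PiE {1..iters A} B)" using B by (intro finite_PiE) auto
  ultimately have "card P \<le> card (PiE {1..iters A} B)"
    by (rule card_inj_on_le)
  also have "\<dots> = (\<Prod>j=1..iters A. card (B j))" by (simp add: card_PiE)
  also have "\<dots> \<le> (\<Prod>j=1..iters A. (2 ^ b) ^ fdim A j)" using B by (intro prod_mono) auto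
  also have "\<dots> = 2 ^ (b * (\<Sum>j = 1..iters A. fdim A j))"
    by (simp add: power_sum power_mult)
  finally show ?thesis by (simp add: P_def card_permutations)
qed

section \<open>A lower bound for the factorial, and the conclusion\<close>

lemma power_self_le_fact_sq: "n ^ n \<le> (fact n :: nat) ^ 2"
proof -
  have "n ^ n = (\<Prod>i=1..n. n)" by simp
  also have "\<dots> \<le> (\<Prod>i=1..n. i * (n + 1 - i))"
  proof (intro prod_mono conjI)
    fix i assume "i \<in> {1..n}"
    \<comment> \<open>In these terms \<open>i * (n + 1 - i)\<close> is (r + 1)(q + 1) = n + r
      q.\<close>
    then obtain r q where "i = Suc r" "n = i + q" by (metis atLeastAtMost_iff le_Suc_ex plus_1_eq_Suc)
    then show "n \<le> i * (n + 1 - i)" by simp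
  qed simp
  also have "\<dots> = (\<Prod>i=1..n. i) * (\<Prod>i=1..n. n + 1 - i)" by (rule prod.distrib)
  also have "(\<Prod>i=1..n. n + 1 - i) = (\<Prod>i=1..n. i)"
    using prod.atLeastAtMost_rev[of "\<lambda>i. i" 1 n] by simp
  finally show ?thesis by (simp add: fact_prod power2_eq_square)
qed

theorem theorem2:
  fixes n k lT lC e :: nat and enc :: "nat \<Rightarrow> real vec"
  assumes "n \<ge> 1" and "k \<ge> 1"
    and "lT \<le> n" and "lC \<le> n"
    and "inj_on enc {1..n}" and "\<And>l. l \<in> {1..n} \<Longrightarrow> enc l \<in> carrier_vec e"
  shows "(\<exists>A. is_mpnn A \<and> iters A = 2 \<and> solves_transfer n k lT lC enc A) \<and>
    (\<forall>b \<ge> 1. \<forall>A. is_mpnn A \<and> b_bit_features b n k lT lC A \<and> solves_transfer n k lT lC enc A \<longrightarrow>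
       (\<Sum>j = 1..iters A. real (fdim A j)) \<ge> real n / (2 * real b) * log 2 (real n / 2))"
proof (intro conjI allI impI)
  have "iters (transfer_mpnn n lT e enc) = 2" by (simp add: transfer_mpnn_def)
  then show "\<exists>A. is_mpnn A \<and> iters A = 2 \<and> solves_transfer n k lT lC enc A"
    using is_mpnn_transfer[where enc = enc, OF assms(1,6)] solves_transfer_transfer_mpnn[OF assms(1-3)] by blast
next
  fix b :: nat and A
  assume b: "b \<ge> 1"
    and A: "is_mpnn A \<and> b_bit_features b n k lT lC A \<and> solves_transfer n k lT lC enc A"
  define D where "D = (\<Sum>j = 1..iters A. fdim A j)"
  \<comment> \<open>Both sides are compared with the square of \<open>fact n\<close>.\<close>
  have "n ^ n \<le> (2 ^ (b * D)) ^ 2"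
    using power_self_le_fact_sq[of n] fact_le_trajectories[OF assms(1,2,5)] A
    unfolding D_def by (meson le_trans power_mono zero_le)
  then have "real (n ^ n) \<le> real ((2 ^ (b * D)) ^ 2)" by (rule of_nat_mono)
  then have "real n ^ n \<le> 2 ^ (b * D * 2)" by (simp add: power_mult)
  then have "log 2 (real n ^ n) \<le> log 2 (2 ^ (b * D * 2))"
    using assms(1) by (subst log_le_cancel_iff) auto
  then have "real n * log 2 (real n) \<le> real (b * D * 2)"
    using assms(1) by (simp add: log_nat_power)
  \<comment> \<open>Halving the argument lowers the logarithm, so the bound with
    \<open>log 2 n\<close> implies the stated one.\<close>
  moreover have "real n * log 2 (real n / 2) \<le> real n * log 2 (real n)"
    using assms(1) by (intro mult_left_mono) auto
  ultimately have "real n * log 2 (real n / 2) \<le> 2 * real b * real D" by simp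
  then have "real n / (2 * real b) * log 2 (real n / 2) \<le> real D"
    using b by (simp add: field_simps)
  then show "(\<Sum>j = 1..iters A. real (fdim A j)) \<ge> real n / (2 * real b) * log 2 (real n / 2)"
    by (simp add: D_def)
qed

end
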